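(* Let $p\in\mathbb{H}[x_1,\dots,x_n]$ and suppose that $n=\sum_{i=0}^r k_i$, where $k_0\ge 0$ and $k_i\ge 1$ for $i\ge 1$. Let $v_0\in\mathbb{H}^{k_0}$ and $A_i,B_i\in\mathbb{R}^{k_i}$ for $1\le i\le r$. Then there exists a multi-affine polynomial $q\in\mathbb{H}[y_1,\dots,y_r]$ such that for all $s_1,\dots,s_r\in\mathbb{S}$ we have $$p(v_0,A_1+B_1s_1,\dots,A_r+B_rs_r)=q(s_1,\dots,s_r).$$
   Context: $\mathbb{H}$ is Hamilton's algebra of real quaternions and $\mathbb{S}=\{q\in\mathbb{H} : q^2=-1\}$. $\mathbb{H}[x_1,\dots,x_n]$ is the ring of polynomials in $n$ central variables: the variables commute with each other and with all coefficients. For $f=\sum a_{i_1,\dots,i_n}x_1^{i_1}\cdots x_n^{i_n}$ (coefficients on the left) and any $a=(a_1,\dots,a_n)\in\mathbb{H}^n$, define $f(a)=\sum a_{i_1,\dots,i_n}a_1^{i_1}\cdots a_n^{i_n}$ (products in this order); likewise for $\mathbb{H}[y_1,\dots,y_r]$. A polynomial is called multi-affine if in each of its monomials all the variables have degree $0$ or $1$. For $A,B\in\mathbb{R}^k$ and $s\in\mathbb{S}$, $A+Bs\in\mathbb{H}^k$ is the vector with coordinates $A_j+B_js$. The point $(v_0,A_1+B_1s_1,\dots,A_r+B_rs_r)\in\mathbb{H}^n$ is the concatenation of the given vectors. *)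

theory Defs
  imports Complex_Main "HOL-Library.Poly_Mapping"
begin

section \<open>Hamilton's quaternions\<close>

text \<open>\<open>Quat a b c d\<close> is \<open>a + b i + c j + d k\<close>.\<close>

codatatype quat = Quat (QRe: real) (QIm1: real) (QIm2: real) (QIm3: real)

lemma quat_eq_iff:
  "x = y \<longleftrightarrow> QRe x = QRe y \<and> QIm1 x = QIm1 y \<and> QIm2 x = QIm2 y \<and> QIm3 x = QIm3 y"
  by (auto intro: quat.expand)

instantiation quat :: ab_group_add
begin

primcorec zero_quat where
  "QRe 0 = 0" | "QIm1 0 = 0" | "QIm2 0 = 0" | "QIm3 0 = 0"

primcorec plus_quat where
  "QRe (x + y) = QRe x + QRe y"
| "QIm1 (x + y) = QIm1 x + QIm1 y"
| "QIm2 (x + y) = QIm2 x + QIm2 y"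
| "QIm3 (x + y) = QIm3 x + QIm3 y"

primcorec uminus_quat where
  "QRe (- x) = - QRe x"
| "QIm1 (- x) = - QIm1 x"
| "QIm2 (- x) = - QIm2 x"
| "QIm3 (- x) = - QIm3 x"

primcorec minus_quat where
  "QRe (x - y) = QRe x - QRe y"
| "QIm1 (x - y) = QIm1 x - QIm1 y"
| "QIm2 (x - y) = QIm2 x - QIm2 y"
| "QIm3 (x - y) = QIm3 x - QIm3 y"

instance
  by standard (simp_all add: quat_eq_iff)

end

instantiation quat :: real_algebra_1
begin

primcorec one_quat where
  "QRe 1 = 1" | "QIm1 1 = 0" | "QIm2 1 = 0" | "QIm3 1 = 0"

primcorec times_quat where
  "QRe (x * y) = QRe x * QRe y - QIm1 x * QIm1 y - QIm2 x * QIm2 y - QIm3 x * QIm3 y"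
| "QIm1 (x * y) = QRe x * QIm1 y + QIm1 x * QRe y + QIm2 x * QIm3 y - QIm3 x * QIm2 y"
| "QIm2 (x * y) = QRe x * QIm2 y - QIm1 x * QIm3 y + QIm2 x * QRe y + QIm3 x * QIm1 y"
| "QIm3 (x * y) = QRe x * QIm3 y + QIm1 x * QIm2 y - QIm2 x * QIm1 y + QIm3 x * QRe y"

primcorec scaleR_quat where
  "QRe (scaleR r x) = r * QRe x"
| "QIm1 (scaleR r x) = r * QIm1 x"
| "QIm2 (scaleR r x) = r * QIm2 x"
| "QIm3 (scaleR r x) = r * QIm3 x"

instance
  by standard (simp_all add: quat_eq_iff algebra_simps)

end

definition imag_units :: "quat set" where
  "imag_units = {q. q\<^sup>2 = - 1}"


section \<open>Polynomials over the quaternions in central variables\<close>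

text \<open>
  A polynomial maps each monomial, given by its exponent vector, to its coefficient.
  Multiplication is the convolution product of \<^theory>\<open>HOL-Library.Poly_Mapping\<close>, in which
  the variables commute with each other and with all coefficients. The variables are numbered
  from 0, so \<open>qpolys n\<close> consists of the polynomials in the variables with numbers below \<open>n\<close>.
\<close>

type_synonym qpoly = "(nat \<Rightarrow>\<^sub>0 nat) \<Rightarrow>\<^sub>0 quat"

definition qpolys :: "nat \<Rightarrow> qpoly set" where
  "qpolys n = {p. \<forall>m\<in>Poly_Mapping.keys p. Poly_Mapping.keys m \<subseteq> {..<n}}"

text \<open>
  Points of the \<open>n\<close>-dimensional quaternionic space are lists of length \<open>n\<close>; evaluation at such a
  point is meant for elements of \<open>qpolys n\<close>. The product over the list is taken from left to right
  in the order of the variables, with the coefficient in front.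
\<close>

definition qeval :: "qpoly \<Rightarrow> quat list \<Rightarrow> quat" where
  "qeval p a =
     (\<Sum>m\<in>Poly_Mapping.keys p.
        Poly_Mapping.lookup p m * (\<Prod>i\<leftarrow>[0..<length a]. (a ! i) ^ Poly_Mapping.lookup m i))"

definition multi_affine :: "qpoly \<Rightarrow> bool" where
  "multi_affine p \<longleftrightarrow> (\<forall>m\<in>Poly_Mapping.keys p. \<forall>i. Poly_Mapping.lookup m i \<le> 1)"

definition affine_pt :: "real list \<Rightarrow> real list \<Rightarrow> quat \<Rightarrow> quat list" where
  "affine_pt A B s = map2 (\<lambda>a b. of_real a + of_real b * s) A B"

end

theory Submission
  imports Defs
begin

text \<open>
  Fix \<open>s\<close> with \<open>s\<^sup>2 = - 1\<close>. The span of \<open>1\<close> and \<open>s\<close> over the reals is a copy of the complex numbers in which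
  \<open>s\<close> is the imaginary unit (\<open>cplx_embed\<close>). The coordinates \<open>a + b s\<close> of one block are the images of
  the complex numbers \<open>a + b \<i>\<close>, so any monomial in them is the image of one complex number
  \<open>c + d \<i>\<close> that is computed from \<open>A\<close> and \<open>B\<close> alone: its value is \<open>c + d s\<close> with real \<open>c\<close>, \<open>d\<close>
  independent of \<open>s\<close> (\<open>mono_value_affine_pt\<close>).

  The variables of different blocks occupy consecutive ranges, so evaluating a monomial never
  interleaves two blocks: its value is a quaternion that depends only on \<open>v\<^sub>0\<close>, followed by a product
  \<open>(c\<^sub>1 + d\<^sub>1 s\<^sub>1) \<dots> (c\<^sub>r + d\<^sub>r s\<^sub>r)\<close> in the order of the blocks (\<open>mono_value_blocks\<close>). Expanding this
  product, and moving the real numbers, which are central, to the left, gives one term for each set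
  of indices \<open>i\<close> at which \<open>s\<^sub>i\<close> is selected (\<open>prod_list_affine_expand\<close>). Each term is the value of a
  squarefree monomial with a coefficient on its left, and evaluation is additive, so the sum of these
  monomials over all terms of \<open>p\<close> is the required polynomial.
\<close>

definition cplx_embed :: "quat \<Rightarrow> complex \<Rightarrow> quat" where
  "cplx_embed s z = of_real (Re z) + of_real (Im z) * s"

lemma cplx_embed_1: "cplx_embed s 1 = 1"
  by (simp add: cplx_embed_def)

lemma cplx_embed_mult:
  assumes "s \<in> imag_units"
  shows "cplx_embed s (z * w) = cplx_embed s z * cplx_embed s w"
proof -
  have "s * s = - 1"
    using assms by (simp add: imag_units_def power2_eq_square)
  then show ?thesis
    by (simp add: cplx_embed_def of_real_def algebra_simps)
qed

lemma cplx_embed_power: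
  "s \<in> imag_units \<Longrightarrow> cplx_embed s (z ^ m) = cplx_embed s z ^ m"
  by (induction m) (simp_all add: cplx_embed_1 cplx_embed_mult)

lemma cplx_embed_prod_list:
  "s \<in> imag_units \<Longrightarrow> cplx_embed s (\<Prod>x\<leftarrow>xs. f x) = (\<Prod>x\<leftarrow>xs. cplx_embed s (f x))"
  by (induction xs) (simp_all add: cplx_embed_1 cplx_embed_mult)

definition mono_value :: "(nat \<Rightarrow> nat) \<Rightarrow> 'a::monoid_mult list \<Rightarrow> 'a" where
  "mono_value e xs = (\<Prod>i\<leftarrow>[0..<length xs]. (xs ! i) ^ e i)"

lemma qeval_eq_mono_value:
  "qeval p a = (\<Sum>m\<in>Poly_Mapping.keys p.
     Poly_Mapping.lookup p m * mono_value (Poly_Mapping.lookup m) a)"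
  by (simp add: qeval_def mono_value_def)

lemma mono_value_append:
  "mono_value e (xs @ ys) = mono_value e xs * mono_value (\<lambda>i. e (i + length xs)) ys"
proof -
  have "[0..<length (xs @ ys)] = [0..<length xs] @ map (\<lambda>i. i + length xs) [0..<length ys]"
    by (simp add: map_add_upt upt_add_eq_append[of 0] add.commute)
  then have "mono_value e (xs @ ys) = (\<Prod>i\<leftarrow>[0..<length xs]. ((xs @ ys) ! i) ^ e i) *
      mono_value (\<lambda>i. e (i + length xs)) ys"
    by (simp only: mono_value_def) (simp add: o_def nth_append)
  also have "(\<Prod>i\<leftarrow>[0..<length xs]. ((xs @ ys) ! i) ^ e i) = mono_value e xs"
    unfolding mono_value_def
    by (intro arg_cong[of _ _ prod_list] map_cong) (auto simp: nth_append)
  finally show ?thesis .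
qed

lemma length_blocks:
  assumes "length v = k 0" and "\<And>i. i \<in> {1..r} \<Longrightarrow> length (P i) = k i"
  shows "length (v @ concat (map P [1..<Suc r])) = (\<Sum>l<Suc r. k l)"
  using assms(2) by (induction r) (simp_all add: assms(1))

text \<open>Block \<open>j\<close> starts after the blocks with smaller numbers, so the exponents of its variables are
  read off with the offset \<open>\<Sum>l<j. k l\<close>.\<close>

lemma mono_value_blocks:
  assumes "length v = k 0" and "\<And>i. i \<in> {1..r} \<Longrightarrow> length (P i) = k i"
  shows "mono_value e (v @ concat (map P [1..<Suc r])) =
    mono_value e v * (\<Prod>j\<leftarrow>[1..<Suc r]. mono_value (\<lambda>i. e (i + (\<Sum>l<j. k l))) (P j))"
  using assms(2)
proof (induction r)
  case 0
  then show ?case by simp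
next
  case (Suc r)
  let ?w = "v @ concat (map P [1..<Suc r])"
  have len: "length ?w = (\<Sum>l<Suc r. k l)"
    using Suc.prems by (intro length_blocks assms(1)) auto
  have "v @ concat (map P [1..<Suc (Suc r)]) = ?w @ P (Suc r)"
    by simp
  then have "mono_value e (v @ concat (map P [1..<Suc (Suc r)])) =
      mono_value e ?w * mono_value (\<lambda>i. e (i + (\<Sum>l<Suc r. k l))) (P (Suc r))"
    by (simp only: mono_value_append len)
  then show ?case
    using Suc by (simp add: mult.assoc)
qed

lemma affine_pt_eq_map_cplx_embed: "affine_pt A B s = map (cplx_embed s) (map2 Complex A B)"
  by (simp add: affine_pt_def cplx_embed_def split_beta o_def)

text \<open>The complex number on the right does not depend on \<open>s\<close>. This is what reduces the degree
  in \<open>s\<close> to at most one.\<close>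

lemma mono_value_affine_pt:
  assumes "s \<in> imag_units"
  shows "mono_value e (affine_pt A B s) = cplx_embed s (mono_value e (map2 Complex A B))"
  unfolding affine_pt_eq_map_cplx_embed mono_value_def cplx_embed_prod_list[OF assms]
    cplx_embed_power[OF assms] length_map
  by (intro arg_cong[of _ _ prod_list] map_cong) auto

text \<open>The factors need not commute, so the index set is a list: each term of the expansion keeps
  the order of the factors.\<close>

lemma prod_list_add_expand:
  fixes x y :: "'i \<Rightarrow> 'a::semiring_1"
  assumes "distinct is"
  shows "(\<Prod>i\<leftarrow>is. x i + y i) = (\<Sum>T\<in>Pow (set is). \<Prod>i\<leftarrow>is. if i \<in> T then y i else x i)"
  using assms
proof (induction "is")
  case Nil
  then show ?case by simp
next
  case (Cons a "is")
  let ?t = "\<lambda>js T. \<Prod>i\<leftarrow>js. if i \<in> T then y i else x i"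
  have a: "a \<notin> set is" using Cons.prems by simp
  have inj: "inj_on (insert a) (Pow (set is))"
    using a by (auto simp: inj_on_def)
  have without: "?t (a # is) T = x a * ?t is T" if "T \<in> Pow (set is)" for T
    using that a by auto
  have same: "?t is (insert a T) = ?t is T" for T
    using a by (intro arg_cong[of _ _ prod_list] map_cong) auto
  have "(\<Sum>T\<in>Pow (set (a # is)). ?t (a # is) T) =
      (\<Sum>T\<in>Pow (set is). ?t (a # is) T) + (\<Sum>T\<in>insert a ` Pow (set is). ?t (a # is) T)"
    using a by (simp only: list.set Pow_insert, intro sum.union_disjoint) auto
  also have "(\<Sum>T\<in>insert a ` Pow (set is). ?t (a # is) T) = (\<Sum>T\<in>Pow (set is). y a * ?t is T)"
    unfolding sum.reindex[OF inj] o_def by (simp only: list.map prod_list.Cons same insertI1 if_True)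
  also have "(\<Sum>T\<in>Pow (set is). ?t (a # is) T) = (\<Sum>T\<in>Pow (set is). x a * ?t is T)"
    by (intro sum.cong refl without)
  finally show ?case
    using Cons by (simp add: sum_distrib_left distrib_right sum.distrib)
qed

lemma prod_list_of_real_mult:
  fixes u :: "'i \<Rightarrow> quat"
  shows "(\<Prod>i\<leftarrow>is. of_real (c i) * u i) = of_real (\<Prod>i\<leftarrow>is. c i) * (\<Prod>i\<leftarrow>is. u i)"
proof (induction "is")
  case Nil
  then show ?case by simp
next
  case (Cons a "is")
  then show ?case
    by (simp add: of_real_def mult.commute)
qed

lemma prod_list_affine_expand:
  fixes u :: "'i \<Rightarrow> quat"
  assumes "distinct is"
  shows "(\<Prod>i\<leftarrow>is. cplx_embed (u i) (z i)) =
    (\<Sum>T\<in>Pow (set is). of_real (\<Prod>i\<leftarrow>is. if i \<in> T then Im (z i) else Re (z i)) *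
      (\<Prod>i\<leftarrow>is. if i \<in> T then u i else 1))"
  unfolding cplx_embed_def prod_list_add_expand[OF assms] prod_list_of_real_mult[symmetric]
  by (intro sum.cong refl arg_cong[of _ _ prod_list] map_cong) auto

definition squarefree_mono :: "nat set \<Rightarrow> (nat \<Rightarrow>\<^sub>0 nat)" where
  "squarefree_mono T = (\<Sum>i\<in>T. Poly_Mapping.single i 1)"

lemma lookup_squarefree_mono:
  "finite T \<Longrightarrow> Poly_Mapping.lookup (squarefree_mono T) i = (if i \<in> T then 1 else 0)"
  by (simp add: squarefree_mono_def lookup_sum lookup_single when_def)

lemma mono_value_squarefree_mono:
  assumes "finite T"
  shows "mono_value (Poly_Mapping.lookup (squarefree_mono T)) xs =
    (\<Prod>i\<leftarrow>[0..<length xs]. if i \<in> T then xs ! i else 1)"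
  unfolding mono_value_def
  by (intro arg_cong[of _ _ prod_list] map_cong) (auto simp: lookup_squarefree_mono assms)

lemma qeval_add: "qeval (p + q) a = qeval p a + qeval q a"
  unfolding qeval_def by (rule setsum_keys_plus_distrib) (simp_all add: distrib_right)

lemma qeval_sum: "qeval (\<Sum>x\<in>X. f x) a = (\<Sum>x\<in>X. qeval (f x) a)"
proof (induction X rule: infinite_finite_induct)
  case (insert x X)
  then show ?case by (simp add: qeval_add)
qed (simp_all add: qeval_def)

lemma qeval_single: "qeval (Poly_Mapping.single m c) a = c * mono_value (Poly_Mapping.lookup m) a"
  by (simp add: qeval_eq_mono_value)

lemma keys_sum_single_subset:
  "Poly_Mapping.keys (\<Sum>x\<in>X. Poly_Mapping.single (g x) (c x)) \<subseteq> g ` X"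
proof (induction X rule: infinite_finite_induct)
  case (insert x X)
  then show ?case
    using keys_add[of "Poly_Mapping.single (g x) (c x)" "\<Sum>x\<in>X. Poly_Mapping.single (g x) (c x)"]
    by (auto split: if_splits)
qed simp_all

text \<open>Evaluation is additive and the sum of the terms \<open>c T\<close> times a squarefree monomial involves no
  other monomials, even where some \<open>c T\<close> vanish. The coefficients stand on the left, as evaluation
  demands, so they may be arbitrary quaternions.\<close>

lemma multi_affine_poly_exists:
  fixes c :: "nat set \<Rightarrow> quat"
  obtains q where "q \<in> qpolys r" and "multi_affine q"
    and "\<And>xs. length xs = r \<Longrightarrow>
      qeval q xs = (\<Sum>T\<in>Pow {..<r}. c T * (\<Prod>i\<leftarrow>[0..<r]. if i \<in> T then xs ! i else 1))"
proof
  let ?q = "\<Sum>T\<in>Pow {..<r}. Poly_Mapping.single (squarefree_mono T) (c T)"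
  have fin: "finite T" if "T \<in> Pow {..<r}" for T
    using that finite_subset by auto
  have keys: "\<exists>T\<in>Pow {..<r}. m = squarefree_mono T" if "m \<in> Poly_Mapping.keys ?q" for m
    using keys_sum_single_subset that by fastforce
  show "?q \<in> qpolys r"
    unfolding qpolys_def
    by (auto dest!: keys simp: in_keys_iff lookup_squarefree_mono fin split: if_splits)
  show "multi_affine ?q"
    unfolding multi_affine_def by (auto dest!: keys simp: lookup_squarefree_mono fin)
  show "qeval ?q xs = (\<Sum>T\<in>Pow {..<r}. c T * (\<Prod>i\<leftarrow>[0..<r]. if i \<in> T then xs ! i else 1))"
    if "length xs = r" for xs
    unfolding qeval_sum qeval_single
    by (intro sum.cong refl) (simp add: mono_value_squarefree_mono fin that)
qed

theorem lemma3p3: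
  fixes p :: qpoly and n r :: nat and k :: "nat \<Rightarrow> nat"
    and v0 :: "quat list" and A B :: "nat \<Rightarrow> real list"
  assumes "p \<in> qpolys n"
    and "n = (\<Sum>i=0..r. k i)"
    and "\<And>i. i \<in> {1..r} \<Longrightarrow> k i \<ge> 1"
    and "length v0 = k 0"
    and "\<And>i. i \<in> {1..r} \<Longrightarrow> length (A i) = k i"
    and "\<And>i. i \<in> {1..r} \<Longrightarrow> length (B i) = k i"
  shows "\<exists>q. q \<in> qpolys r \<and> multi_affine q \<and>
    (\<forall>s :: nat \<Rightarrow> quat. (\<forall>i\<in>{1..r}. s i \<in> imag_units) \<longrightarrow>
       qeval p (v0 @ concat (map (\<lambda>i. affine_pt (A i) (B i) (s i)) [1..<Suc r])) =
       qeval q (map s [1..<Suc r]))"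
proof -
  let ?K = "Poly_Mapping.keys p" and ?e = Poly_Mapping.lookup
  \<comment> \<open>Blocks are numbered from 1 but the variables of \<open>q\<close> from 0, hence the shift by \<open>Suc\<close>.\<close>
  define z where "z m i =
    mono_value (\<lambda>l. ?e m (l + (\<Sum>j<Suc i. k j))) (map2 Complex (A (Suc i)) (B (Suc i)))" for m i
  define d where "d m T = (\<Prod>i\<leftarrow>[0..<r]. if i \<in> T then Im (z m i) else Re (z m i))" for m T
  define c where "c T = (\<Sum>m\<in>?K. ?e p m * mono_value (?e m) v0 * of_real (d m T))" for T
  obtain q where q: "q \<in> qpolys r" "multi_affine q"
    and eval_q: "\<And>xs. length xs = r \<Longrightarrow>
      qeval q xs = (\<Sum>T\<in>Pow {..<r}. c T * (\<Prod>i\<leftarrow>[0..<r]. if i \<in> T then xs ! i else 1))"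
    by (rule multi_affine_poly_exists[where r = r and c = c]) (rule that)
  have "qeval p (v0 @ concat (map (\<lambda>i. affine_pt (A i) (B i) (s i)) [1..<Suc r])) =
      qeval q (map s [1..<Suc r])" if s: "\<forall>i\<in>{1..r}. s i \<in> imag_units" for s
  proof -
    let ?P = "\<lambda>i. affine_pt (A i) (B i) (s i)"
    let ?u = "\<lambda>T. \<Prod>i\<leftarrow>[0..<r]. if i \<in> T then s (Suc i) else 1"
    have len: "length (?P i) = k i" if "i \<in> {1..r}" for i
      using assms(5,6)[OF that] by (simp add: affine_pt_def)
    have term_eq: "mono_value (?e m) (v0 @ concat (map ?P [1..<Suc r])) =
        mono_value (?e m) v0 * (\<Sum>T\<in>Pow {..<r}. of_real (d m T) * ?u T)" for m
    proof -
      have "mono_value (?e m) (v0 @ concat (map ?P [1..<Suc r])) = mono_value (?e m) v0 *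
          (\<Prod>j\<leftarrow>[1..<Suc r]. mono_value (\<lambda>i. ?e m (i + (\<Sum>l<j. k l))) (?P j))"
        by (rule mono_value_blocks[where k = k, OF assms(4)]) (rule len)
      also have "(\<Prod>j\<leftarrow>[1..<Suc r]. mono_value (\<lambda>i. ?e m (i + (\<Sum>l<j. k l))) (?P j)) =
          (\<Prod>i\<leftarrow>[0..<r]. mono_value (\<lambda>l. ?e m (l + (\<Sum>j<Suc i. k j))) (?P (Suc i)))"
        by (simp only: One_nat_def map_Suc_upt[symmetric] map_map o_def)
      also have "\<dots> = (\<Prod>i\<leftarrow>[0..<r]. cplx_embed (s (Suc i)) (z m i))"
        using s unfolding z_def
        by (intro arg_cong[of _ _ prod_list] map_cong refl mono_value_affine_pt) auto
      also have "\<dots> = (\<Sum>T\<in>Pow {..<r}. of_real (d m T) * ?u T)"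
        by (simp add: prod_list_affine_expand d_def atLeast0LessThan)
      finally show ?thesis .
    qed
    have "qeval p (v0 @ concat (map ?P [1..<Suc r])) =
        (\<Sum>m\<in>?K. \<Sum>T\<in>Pow {..<r}. ?e p m * mono_value (?e m) v0 * of_real (d m T) * ?u T)"
      unfolding qeval_eq_mono_value term_eq by (simp add: sum_distrib_left mult.assoc)
    also have "\<dots> = (\<Sum>T\<in>Pow {..<r}. c T * ?u T)"
      unfolding c_def sum_distrib_right by (rule sum.swap)
    also have "\<dots> = qeval q (map s [1..<Suc r])"
    proof -
      have "?u T = (\<Prod>i\<leftarrow>[0..<r]. if i \<in> T then map s [1..<Suc r] ! i else 1)" for T
        by (intro arg_cong[of _ _ prod_list] map_cong) (auto simp del: upt_Suc)
      then show ?thesis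
        by (simp only: eval_q length_map length_upt diff_Suc_1)
    qed
    finally show ?thesis .
  qed
  with q show ?thesis by blast
qed

end
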